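(* Let $p>1$, let $N\ge 1$ be an integer, let $\lambda_1,\dots,\lambda_N>0$, $\Lambda_n=\sum_{i=1}^n\lambda_i$, and let $A$ be the $N\times N$ weighted mean matrix generated by $\{\lambda_n\}_{n=1}^N$. Suppose $U_{p,N}>0$ is a constant such that $$\sum_{n=1}^{N}\Big(\sum_{k=1}^{n}\frac{\lambda_k}{\Lambda_n}a_k\Big)^p\le U_{p,N}\sum_{n=1}^{N}a_n^p\qquad\text{for all } a_1,\dots,a_N\ge 0 .$$ If for every $1\le k\le N-1$ $$\frac{1}{\Lambda_k}\ \ge\ U_{p,N}\Big(\frac{1}{\lambda_k}-\frac{1}{\lambda_{k+1}}\Big),$$ then the $l^p$ norm of $A$ is determined on decreasing sequences, i.e. $$\|A\|_{p,p}=\sup\Big\{\|A\mathbf a\|_p:\ \|\mathbf a\|_p=1,\ \mathbf a=(a_1,\dots,a_N),\ a_1\ge a_2\ge\dots\ge a_N\ge 0\Big\}.$$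
   Context: The weighted mean matrix generated by $\{\lambda_n\}_{n=1}^N$ is the lower triangular matrix $A=(a_{n,k})$ with $a_{n,k}=\lambda_k/\Lambda_n$ for $1\le k\le n$ and $a_{n,k}=0$ for $k>n$. For a vector $\mathbf a$, $\|\mathbf a\|_p=(\sum_n|a_n|^p)^{1/p}$, and $\|A\|_{p,p}=\sup_{\|\mathbf a\|_p=1}\|A\mathbf a\|_p$, the supremum being over all complex vectors $\mathbf a$. *)

theory Defs
  imports "HOL-Analysis.Analysis"
begin

text \<open>
  Vectors of length \<open>N\<close> and \<open>N \<times> N\<close> matrices are functions on the indices \<open>1, \<dots>, N\<close>;
  values at other indices are never used.
\<close>

definition lp_norm :: "real \<Rightarrow> nat \<Rightarrow> (nat \<Rightarrow> complex) \<Rightarrow> real" where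
  "lp_norm p N a = (\<Sum>n=1..N. cmod (a n) powr p) powr (1 / p)"

definition mat_app :: "nat \<Rightarrow> (nat \<Rightarrow> nat \<Rightarrow> complex) \<Rightarrow> (nat \<Rightarrow> complex) \<Rightarrow> nat \<Rightarrow> complex" where
  "mat_app N A a n = (\<Sum>k=1..N. A n k * a k)"

text \<open>
  The supremum is a real one; for \<open>p > 1\<close> and \<open>N \<ge> 1\<close> the set is nonempty and bounded above,
  since the dimension is finite.
\<close>

definition lp_op_norm :: "real \<Rightarrow> nat \<Rightarrow> (nat \<Rightarrow> nat \<Rightarrow> complex) \<Rightarrow> real" where
  "lp_op_norm p N A = Sup {lp_norm p N (mat_app N A a) | a. lp_norm p N a = 1}"

definition partial_sum :: "(nat \<Rightarrow> real) \<Rightarrow> nat \<Rightarrow> real" where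
  "partial_sum l n = (\<Sum>i=1..n. l i)"

definition weighted_mean_matrix :: "(nat \<Rightarrow> real) \<Rightarrow> nat \<Rightarrow> nat \<Rightarrow> complex" where
  "weighted_mean_matrix l n k =
     (if 1 \<le> k \<and> k \<le> n then complex_of_real (l k / partial_sum l n) else 0)"

end

theory Submission
  imports Defs
begin

text \<open>
  By compactness the norm is attained at some \<open>a \<ge> 0\<close>. With \<open>M\<close> the \<open>p\<close>-th power of the norm and
  \<open>A\<^sub>n\<close> the weighted means of \<open>a\<close>, the Lagrange condition
  \<open>(\<Sum>n\<ge>k. \<lambda>\<^sub>k / \<Lambda>\<^sub>n * A\<^sub>n\<^sup>p\<^sup>-\<^sup>1) = M * a\<^sub>k\<^sup>p\<^sup>-\<^sup>1\<close> taken at \<open>k\<close> and \<open>k + 1\<close> gives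
  \<open>A\<^sub>k\<^sup>p\<^sup>-\<^sup>1 / \<Lambda>\<^sub>k = M * (a\<^sub>k\<^sup>p\<^sup>-\<^sup>1 / \<lambda>\<^sub>k - a\<^sub>k\<^sub>+\<^sub>1\<^sup>p\<^sup>-\<^sup>1 / \<lambda>\<^sub>k\<^sub>+\<^sub>1)\<close>. If \<open>a\<close> decreases up to \<open>k\<close> then
  \<open>A\<^sub>k \<ge> a\<^sub>k\<close>, and since \<open>M \<le> U\<close> the hypothesis on \<open>\<lambda>\<close> forces \<open>a\<^sub>k\<^sub>+\<^sub>1 \<le> a\<^sub>k\<close>.
\<close>

section \<open>Weighted means and the derivative of a power of an absolute value\<close>

definition weighted_mean :: "(nat \<Rightarrow> real) \<Rightarrow> (nat \<Rightarrow> real) \<Rightarrow> nat \<Rightarrow> real" where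
  "weighted_mean l a n = (\<Sum>k=1..n. l k / partial_sum l n * a k)"

lemma partial_sum_pos:
  assumes "\<forall>n\<in>{1..N}. l n > 0" "n \<in> {1..N}"
  shows "partial_sum l n > 0"
  unfolding partial_sum_def using assms by (intro sum_pos) auto

lemma weighted_mean_nonneg:
  assumes "\<forall>n\<in>{1..N}. l n > 0" "\<forall>n\<in>{1..N}. a n \<ge> 0" "n \<in> {1..N}"
  shows "weighted_mean l a n \<ge> 0"
  unfolding weighted_mean_def using assms partial_sum_pos[OF assms(1,3)]
  by (intro sum_nonneg mult_nonneg_nonneg divide_nonneg_nonneg) (auto intro: less_imp_le)

lemma mat_app_of_real:
  assumes "n \<in> {1..N}"
  shows "mat_app N (weighted_mean_matrix l) (\<lambda>n. complex_of_real (a n)) n =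
    complex_of_real (weighted_mean l a n)"
proof -
  have "(\<Sum>k=1..N. weighted_mean_matrix l n k * of_real (a k)) =
      (\<Sum>k=1..n. weighted_mean_matrix l n k * of_real (a k))"
    using assms by (intro sum.mono_neutral_right) (auto simp: weighted_mean_matrix_def)
  also have "\<dots> = (\<Sum>k=1..n. of_real (l k / partial_sum l n * a k))"
    by (intro sum.cong) (auto simp: weighted_mean_matrix_def)
  finally show ?thesis by (simp add: mat_app_def weighted_mean_def)
qed

text \<open>The triangle inequality with nonnegative matrix entries: replacing a complex vector by
  its moduli keeps its norm and can only enlarge its image, so nonnegative real vectors decide the
  operator norm.\<close>

lemma cmod_mat_app_le:
  assumes "\<forall>n\<in>{1..N}. l n > 0" "n \<in> {1..N}"
  shows "cmod (mat_app N (weighted_mean_matrix l) b n) \<le> weighted_mean l (\<lambda>k. cmod (b k)) n"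
proof -
  have "(\<Sum>k=1..N. weighted_mean_matrix l n k * b k) =
      (\<Sum>k=1..n. weighted_mean_matrix l n k * b k)"
    using assms by (intro sum.mono_neutral_right) (auto simp: weighted_mean_matrix_def)
  also have "cmod \<dots> \<le> (\<Sum>k=1..n. cmod (weighted_mean_matrix l n k * b k))"
    by (rule norm_sum)
  also have "\<dots> = (\<Sum>k=1..n. l k / partial_sum l n * cmod (b k))"
  proof (intro sum.cong refl)
    fix k assume k: "k \<in> {1..n}"
    then have "l k > 0" using assms by auto
    with k show "cmod (weighted_mean_matrix l n k * b k) = l k / partial_sum l n * cmod (b k)"
      using partial_sum_pos[OF assms]
      by (auto simp: weighted_mean_matrix_def norm_mult norm_divide)
  qed
  finally show ?thesis by (simp add: mat_app_def weighted_mean_def)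
qed

lemma weighted_mean_cmult: "weighted_mean l (\<lambda>k. c * a k) n = c * weighted_mean l a n"
  unfolding weighted_mean_def sum_distrib_left by (intro sum.cong) auto

text \<open>The real case of the preceding triangle inequality, read off by embedding
  \<open>a\<close> into the complex vectors.\<close>

lemma weighted_mean_abs_le:
  assumes "\<forall>n\<in>{1..N}. l n > 0" "n \<in> {1..N}"
  shows "\<bar>weighted_mean l a n\<bar> \<le> weighted_mean l (\<lambda>k. \<bar>a k\<bar>) n"
  using cmod_mat_app_le[OF assms, of "\<lambda>n. complex_of_real (a n)"]
  by (simp only: mat_app_of_real[OF assms(2)] norm_of_real)

lemma weighted_mean_fun_upd:
  assumes "1 \<le> k"
  shows "weighted_mean l (a(k := a k + t)) n =
    weighted_mean l a n + t * (if k \<le> n then l k / partial_sum l n else 0)"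
proof -
  have "weighted_mean l (a(k := a k + t)) n =
      (\<Sum>j=1..n. l j / partial_sum l n * a j + (if j = k then l k / partial_sum l n * t else 0))"
    unfolding weighted_mean_def by (intro sum.cong) (auto simp: distrib_left add_divide_distrib)
  also have "\<dots> = weighted_mean l a n + (if k \<in> {1..n} then l k / partial_sum l n * t else 0)"
    unfolding sum.distrib weighted_mean_def by (simp add: sum.delta)
  finally show ?thesis using assms by auto
qed

text \<open>The mean is a convex combination of \<open>a 1, ..., a n\<close>, all of which are at
  least \<open>a n\<close>.\<close>

lemma weighted_mean_ge_last:
  assumes "\<forall>n\<in>{1..N}. l n > 0" "n \<in> {1..N}" "\<And>k. k \<in> {1..n} \<Longrightarrow> a n \<le> a k"
  shows "a n \<le> weighted_mean l a n"
proof -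
  have P: "partial_sum l n > 0" using partial_sum_pos[OF assms(1,2)] .
  have "a n = (\<Sum>k=1..n. l k / partial_sum l n * a n)"
    using P unfolding sum_distrib_right[symmetric] sum_divide_distrib[symmetric]
    by (simp add: partial_sum_def)
  also have "\<dots> \<le> weighted_mean l a n"
    unfolding weighted_mean_def
  proof (intro sum_mono mult_left_mono assms(3))
    fix k assume "k \<in> {1..n}"
    then have "l k > 0" using assms(1,2) by auto
    then show "0 \<le> l k / partial_sum l n" using P by simp
  qed
  finally show ?thesis .
qed

text \<open>The absolute value allows a two-sided derivative at \<open>x = 0\<close> as well.
  Coordinates of an extremal vector that vanish can then be perturbed in both directions, and the
  Lagrange condition is an equality there too.\<close>

lemma has_real_derivative_abs_powr:
  fixes x c p :: real
  assumes "p > 1" "x \<ge> 0"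
  shows "((\<lambda>t. \<bar>x + t * c\<bar> powr p) has_real_derivative p * x powr (p - 1) * c) (at 0)"
proof (cases "x = 0")
  case True
  \<comment> \<open>At \<open>x = 0\<close> the difference quotient has absolute value
    \<open>|t| powr (p - 1) * |c| powr p\<close>, which tends to 0 since \<open>p > 1\<close>; the
    claimed derivative is 0 as well.\<close>
  have "((\<lambda>t::real. \<bar>t\<bar> powr (p - 1)) \<longlongrightarrow> 0) (at 0)"
    using assms(1) by (intro tendsto_eq_intros refl | simp)+
  then have "((\<lambda>t. \<bar>t\<bar> powr (p - 1) * \<bar>c\<bar> powr p) \<longlongrightarrow> 0) (at 0)"
    using tendsto_mult_left_zero by blast
  moreover have "norm ((\<bar>x + (0 + t) * c\<bar> powr p - \<bar>x + 0 * c\<bar> powr p) / t) =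
      \<bar>t\<bar> powr (p - 1) * \<bar>c\<bar> powr p" if "t \<noteq> 0" for t
    using that True by (simp add: abs_mult powr_mult powr_diff)
  ultimately have "((\<lambda>t. (\<bar>x + (0 + t) * c\<bar> powr p - \<bar>x + 0 * c\<bar> powr p) / t) \<longlongrightarrow> 0) (at 0)"
    by (subst tendsto_norm_zero_iff[symmetric])
      (auto simp: eventually_at_filter elim!: Lim_transform_eventually)
  then show ?thesis using True by (simp add: DERIV_def)
next
  case False
  with assms have "x > 0" by simp
  then have "((\<lambda>t. (x + t * c) powr p) has_real_derivative p * x powr (p - 1) * c) (at 0)"
    by (auto intro!: derivative_eq_intros)
  moreover have "\<forall>\<^sub>F t in nhds 0. \<bar>x + t * c\<bar> powr p = (x + t * c) powr p"
  proof -
    have "((\<lambda>t. x + t * c) \<longlongrightarrow> x + 0 * c) (nhds 0)"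
      by (intro tendsto_intros filterlim_ident)
    then have "\<forall>\<^sub>F t in nhds 0. x + t * c > 0"
      using \<open>x > 0\<close> by (intro order_tendstoD(1)) auto
    then show ?thesis by eventually_elim auto
  qed
  ultimately show ?thesis by (subst DERIV_cong_ev[OF refl _ refl])
qed

section \<open>Extremal vectors and their stationarity condition\<close>

lemma weighted_mean_maximizer:
  fixes p :: real
  assumes "p > 1" "N \<ge> 1"
  obtains a where "\<forall>n\<in>{1..N}. a n \<ge> 0" "(\<Sum>n=1..N. a n powr p) = 1"
    "\<And>b. \<forall>n\<in>{1..N}. b n \<ge> 0 \<Longrightarrow> (\<Sum>n=1..N. b n powr p) = 1 \<Longrightarrow>
       (\<Sum>n=1..N. \<bar>weighted_mean l b n\<bar> powr p) \<le> (\<Sum>n=1..N. \<bar>weighted_mean l a n\<bar> powr p)"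
proof -
  \<comment> \<open>Vectors are functions on all of \<open>nat\<close>, so coordinates outside
    \<open>{1..N}\<close> are pinned to 0 to make the box compact by Tychonoff. The range
    \<open>{0..1}\<close> loses nothing on the nonnegative unit sphere.\<close>
  define B where "B = (\<lambda>n. if n \<in> {1..N} then {0..1::real} else {0})"
  \<comment> \<open>With absolute values the constraint is continuous on the whole function space,
    so its solution set is closed there.\<close>
  define K where "K = PiE UNIV B \<inter> {a. (\<Sum>n=1..N. \<bar>a n\<bar> powr p) = 1}"
  have coord: "continuous_on S (\<lambda>a::nat \<Rightarrow> real. a n)" for S n
    by (rule continuous_on_product_coordinates[THEN continuous_on_subset]) auto
  have "compact (B n)" for n by (simp add: B_def)
  then have "compact (PiE UNIV B)"
    using compactin_PiE[of "\<lambda>_. euclideanreal" UNIV B]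
    by (simp add: euclidean_product_topology)
  moreover have "closed {a::nat \<Rightarrow> real. (\<Sum>n=1..N. \<bar>a n\<bar> powr p) = 1}"
    using assms(1) by (intro closed_Collect_eq continuous_intros continuous_on_powr' coord) auto
  ultimately have "compact K" unfolding K_def by (rule compact_Int_closed)
  moreover have "(\<lambda>n. if n = 1 then 1 else 0) \<in> K"
    using assms by (auto simp: K_def B_def if_distrib[of "\<lambda>x. x powr p"] cong: if_cong)
  moreover have "continuous_on K (\<lambda>a. \<Sum>n=1..N. \<bar>weighted_mean l a n\<bar> powr p)"
    unfolding weighted_mean_def
    using assms(1) by (intro continuous_intros continuous_on_powr' coord) auto
  ultimately obtain a where a: "a \<in> K" and
    max: "\<And>b. b \<in> K \<Longrightarrow>
      (\<Sum>n=1..N. \<bar>weighted_mean l b n\<bar> powr p) \<le> (\<Sum>n=1..N. \<bar>weighted_mean l a n\<bar> powr p)"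
    using continuous_attains_sup[of K] by blast
  have nn: "\<forall>n\<in>{1..N}. a n \<ge> 0"
  proof
    fix n assume "n \<in> {1..N}"
    then show "a n \<ge> 0" using a by (auto simp: K_def B_def PiE_iff dest!: spec[of _ n])
  qed
  show thesis
  proof (rule that[OF nn])
    have "(\<Sum>n=1..N. a n powr p) = (\<Sum>n=1..N. \<bar>a n\<bar> powr p)"
      using nn by (intro sum.cong) auto
    then show "(\<Sum>n=1..N. a n powr p) = 1" using a by (simp add: K_def)
  next
    fix b :: "nat \<Rightarrow> real"
    assume b: "\<forall>n\<in>{1..N}. b n \<ge> 0" "(\<Sum>n=1..N. b n powr p) = 1"
    \<comment> \<open>Membership in \<open>K\<close> requires zeros off \<open>{1..N}\<close>; this
      truncation changes neither the norm nor the means in question.\<close>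
    define b' where "b' n = (if n \<in> {1..N} then b n else 0)" for n
    have "b n \<le> 1" if "n \<in> {1..N}" for n
    proof -
      have "b n powr p \<le> (\<Sum>n=1..N. b n powr p)"
        using that by (intro member_le_sum) auto
      then show ?thesis
        using b(2) assms(1) gr_one_powr[of "b n" p] by linarith
    qed
    moreover have "(\<Sum>n=1..N. \<bar>b' n\<bar> powr p) = (\<Sum>n=1..N. b n powr p)"
      using b by (intro sum.cong) (auto simp: b'_def)
    ultimately have "b' \<in> K" using b by (auto simp: K_def B_def b'_def)
    moreover have "weighted_mean l b' n = weighted_mean l b n" if "n \<in> {1..N}" for n
      unfolding weighted_mean_def using that by (intro sum.cong) (auto simp: b'_def)
    ultimately show "(\<Sum>n=1..N. \<bar>weighted_mean l b n\<bar> powr p) \<le>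
        (\<Sum>n=1..N. \<bar>weighted_mean l a n\<bar> powr p)"
      using max[of b'] by simp
  qed
qed

text \<open>Homogeneity removes the normalisation and passing to absolute values removes the sign
  condition. The resulting bound for all real vectors permits arbitrary perturbations of a
  maximizer.\<close>

lemma weighted_mean_bound_of_unit_bound:
  fixes p M :: real
  assumes "p > 1" and pos: "\<forall>n\<in>{1..N}. l n > 0"
    and unit: "\<And>b. \<forall>n\<in>{1..N}. b n \<ge> 0 \<Longrightarrow> (\<Sum>n=1..N. b n powr p) = 1 \<Longrightarrow>
       (\<Sum>n=1..N. \<bar>weighted_mean l b n\<bar> powr p) \<le> M"
  shows "(\<Sum>n=1..N. \<bar>weighted_mean l b n\<bar> powr p) \<le> M * (\<Sum>n=1..N. \<bar>b n\<bar> powr p)"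
proof -
  define S where "S = (\<Sum>n=1..N. \<bar>b n\<bar> powr p)"
  have le: "(\<Sum>n=1..N. \<bar>weighted_mean l b n\<bar> powr p) \<le>
      (\<Sum>n=1..N. \<bar>weighted_mean l (\<lambda>k. \<bar>b k\<bar>) n\<bar> powr p)"
    using assms(1) weighted_mean_abs_le[OF pos, of _ b]
    by (intro sum_mono powr_mono2) (auto intro: order_trans[OF _ abs_ge_self])
  have "S \<ge> 0" unfolding S_def by (intro sum_nonneg) auto
  then consider "S = 0" | "S > 0" by linarith
  then show ?thesis
  proof cases
    case 1
    then have "b n = 0" if "n \<in> {1..N}" for n
      using that unfolding S_def by (subst (asm) sum_nonneg_eq_0_iff) auto
    then have "weighted_mean l b n = 0" if "n \<in> {1..N}" for n
      using that unfolding weighted_mean_def by (intro sum.neutral) auto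
    then show ?thesis using 1 S_def by simp
  next
    case 2
    \<comment> \<open>The scaling that gives \<open>c * |b|\<close> unit norm, since
      \<open>c powr p * S = 1\<close>.\<close>
    define c where "c = S powr (- 1 / p)"
    have "c powr p = S powr -1" using assms(1) by (simp add: c_def powr_powr)
    then have c: "c > 0" "c powr p * S = 1"
      using 2 by (auto simp: c_def powr_minus)
    have "(\<Sum>n=1..N. (c * \<bar>b n\<bar>) powr p) = c powr p * S"
      unfolding S_def sum_distrib_left using c by (intro sum.cong) (auto simp: powr_mult)
    then have "(\<Sum>n=1..N. \<bar>weighted_mean l (\<lambda>k. c * \<bar>b k\<bar>) n\<bar> powr p) \<le> M"
      using c by (intro unit) auto
    also have "(\<Sum>n=1..N. \<bar>weighted_mean l (\<lambda>k. c * \<bar>b k\<bar>) n\<bar> powr p) =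
        c powr p * (\<Sum>n=1..N. \<bar>weighted_mean l (\<lambda>k. \<bar>b k\<bar>) n\<bar> powr p)" (is "_ = _ * ?X")
      unfolding weighted_mean_cmult abs_mult sum_distrib_left
      using c by (intro sum.cong) (auto simp: powr_mult)
    finally have "S * (c powr p * ?X) \<le> S * M" using 2 by (intro mult_left_mono) auto
    moreover have "S * (c powr p * ?X) = ?X"
      using c(2) by (simp only: mult.assoc[symmetric] mult.commute[of S] mult_1)
    ultimately have "?X \<le> M * S" by (simp only: mult.commute)
    with le show ?thesis by (simp add: S_def)
  qed
qed

text \<open>Subtracting \<open>M\<close> times the constraint turns the constrained problem into a
  free one: along the \<open>k\<close>-th coordinate direction the difference \<open>g\<close> is at
  most 0 and vanishes at \<open>t = 0\<close>, so its derivative there is 0. Dividing by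
  \<open>p * l k\<close> gives the claim.\<close>

lemma weighted_mean_lagrange:
  fixes p M :: real
  assumes "p > 1" and pos: "\<forall>n\<in>{1..N}. l n > 0" and nn: "\<forall>n\<in>{1..N}. a n \<ge> 0"
    and le: "\<And>b. (\<Sum>n=1..N. \<bar>weighted_mean l b n\<bar> powr p) \<le> M * (\<Sum>n=1..N. \<bar>b n\<bar> powr p)"
    and eq: "(\<Sum>n=1..N. \<bar>weighted_mean l a n\<bar> powr p) = M * (\<Sum>n=1..N. \<bar>a n\<bar> powr p)"
    and k: "k \<in> {1..N}"
  shows "(\<Sum>n=k..N. weighted_mean l a n powr (p - 1) / partial_sum l n) =
    M * a k powr (p - 1) / l k"
proof -
  define c where "c n = (if k \<le> n then l k / partial_sum l n else 0)" for n
  define d where "d n = (if n = k then 1 else 0 :: real)" for n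
  define g where "g t = (\<Sum>n=1..N. \<bar>weighted_mean l a n + t * c n\<bar> powr p) -
      M * (\<Sum>n=1..N. \<bar>a n + t * d n\<bar> powr p)" for t
  have "g t \<le> g 0" for t
  proof -
    have "g 0 = 0" using eq by (simp add: g_def)
    moreover have "\<bar>a n + t * d n\<bar> = \<bar>(a(k := a k + t)) n\<bar>" for n by (simp add: d_def)
    ultimately show ?thesis
      using le[of "a(k := a k + t)"] k weighted_mean_fun_upd[of k l a t] by (simp add: g_def c_def)
  qed
  moreover have "(g has_real_derivative
      (\<Sum>n=1..N. p * weighted_mean l a n powr (p - 1) * c n) -
      M * (\<Sum>n=1..N. p * a n powr (p - 1) * d n)) (at 0)"
    unfolding g_def using assms(1) nn weighted_mean_nonneg[OF pos nn]
    by (intro DERIV_diff DERIV_cmult DERIV_sum has_real_derivative_abs_powr) auto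
  ultimately have "(\<Sum>n=1..N. p * weighted_mean l a n powr (p - 1) * c n) =
      M * (\<Sum>n=1..N. p * a n powr (p - 1) * d n)"
    using DERIV_local_max[of g _ 0 1] by fastforce
  also have "(\<Sum>n=1..N. p * a n powr (p - 1) * d n) = p * a k powr (p - 1)"
    using k by (simp add: d_def if_distrib sum.delta cong: if_cong)
  also have "(\<Sum>n=1..N. p * weighted_mean l a n powr (p - 1) * c n) =
      (\<Sum>n=k..N. p * weighted_mean l a n powr (p - 1) * c n)"
    using k by (intro sum.mono_neutral_right) (auto simp: c_def)
  also have "\<dots> = p * l k * (\<Sum>n=k..N. weighted_mean l a n powr (p - 1) / partial_sum l n)"
    unfolding sum_distrib_left by (intro sum.cong) (auto simp: c_def)
  finally have "p * (l k * (\<Sum>n=k..N. weighted_mean l a n powr (p - 1) / partial_sum l n)) =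
      p * (M * a k powr (p - 1))" by (simp add: algebra_simps)
  moreover have "l k > 0" using pos k by auto
  ultimately show ?thesis using assms(1) by (simp add: field_simps)
qed

section \<open>Monotonicity of extremal vectors and equality of the two suprema\<close>

lemma decreasing_of_lagrange:
  fixes p M U :: real
  assumes "p > 1" and pos: "\<forall>n\<in>{1..N}. l n > 0" and nn: "\<forall>n\<in>{1..N}. a n \<ge> 0"
    and M: "0 < M" "M \<le> U"
    and cond: "\<forall>k. 1 \<le> k \<and> k + 1 \<le> N \<longrightarrow> 1 / partial_sum l k \<ge> U * (1 / l k - 1 / l (k + 1))"
    and lagrange: "\<And>k. k \<in> {1..N} \<Longrightarrow>
      (\<Sum>n=k..N. weighted_mean l a n powr (p - 1) / partial_sum l n) = M * a k powr (p - 1) / l k"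
  shows "antimono_on {1..N} a"
proof -
  \<comment> \<open>Induction on the length \<open>m\<close> of an initial segment on which
    \<open>a\<close> decreases: decrease up to \<open>k\<close> bounds the \<open>k\<close>-th mean
    below by \<open>a k\<close>, which controls the next coordinate.\<close>
  have "\<forall>i\<in>{1..m}. \<forall>j\<in>{i..m}. a j \<le> a i" if "m \<le> N" for m
    using that
  proof (induction m)
    case 0
    then show ?case by simp
  next
    case (Suc k)
    have IH: "\<forall>i\<in>{1..k}. \<forall>j\<in>{i..k}. a j \<le> a i" using Suc by simp
    have "a (Suc k) \<le> a k" if "k \<ge> 1"
    proof -
      have k: "k \<in> {1..N}" and k': "Suc k \<in> {1..N}" using that Suc.prems by auto
      have "a k \<le> weighted_mean l a k"
        using IH by (intro weighted_mean_ge_last[OF pos k]) auto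
      then have mono: "a k powr (p - 1) \<le> weighted_mean l a k powr (p - 1)"
        using nn k assms(1) by (intro powr_mono2) auto
      have P: "partial_sum l k > 0" and lk: "l k > 0" and lk': "l (Suc k) > 0"
        using partial_sum_pos[OF pos k] pos k k' by auto
      let ?D = "1 / l k - 1 / l (Suc k)"
      \<comment> \<open>The hypothesis passes from \<open>U\<close> to \<open>M\<close>: for
        \<open>?D >= 0\<close> by \<open>M <= U\<close>, and for \<open>?D < 0\<close> because the
        left side is then at most 0.\<close>
      have "M * ?D \<le> 1 / partial_sum l k"
      proof (cases "?D \<ge> 0")
        case True
        then have "M * ?D \<le> U * ?D" using M by (intro mult_right_mono)
        then show ?thesis using cond that Suc.prems by force
      next
        case False
        then have "M * ?D \<le> 0" using M by (intro mult_nonneg_nonpos) auto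
        then show ?thesis using P by (smt (verit) divide_pos_pos)
      qed
      then have "a k powr (p - 1) * (M * ?D) \<le> a k powr (p - 1) * (1 / partial_sum l k)"
        by (intro mult_left_mono) auto
      also have "\<dots> \<le> weighted_mean l a k powr (p - 1) / partial_sum l k"
        using mono P by (simp add: divide_right_mono)
      \<comment> \<open>The sums in the conditions at \<open>k\<close> and \<open>Suc k\<close>
        differ exactly by the term \<open>n = k\<close>.\<close>
      also have "\<dots> = M * a k powr (p - 1) / l k - M * a (Suc k) powr (p - 1) / l (Suc k)"
        using lagrange[OF k] lagrange[OF k'] k by (simp add: sum.atLeast_Suc_atMost)
      finally have "M * a (Suc k) powr (p - 1) / l (Suc k) \<le> M * a k powr (p - 1) / l (Suc k)"
        by (simp add: algebra_simps)
      then have "a (Suc k) powr (p - 1) \<le> a k powr (p - 1)"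
        using M lk' by (simp add: divide_le_cancel)
      then show ?thesis
        using powr_less_mono2[of "p - 1" "a k" "a (Suc k)"] nn k assms(1) by force
    qed
    then show ?case using IH
      by (auto simp: le_Suc_eq) (metis atLeastAtMost_iff le_refl order_trans One_nat_def)+
  qed
  then show ?thesis by (auto intro!: monotone_onI)
qed

theorem theorem2p1:
  fixes p U :: real and N :: nat and l :: "nat \<Rightarrow> real"
  assumes "p > 1" and "N \<ge> 1"
    and "\<forall>n\<in>{1..N}. l n > 0"
    and "U > 0"
    and "\<forall>a :: nat \<Rightarrow> real. (\<forall>n\<in>{1..N}. a n \<ge> 0) \<longrightarrow>
           (\<Sum>n=1..N. (\<Sum>k=1..n. l k / partial_sum l n * a k) powr p)
             \<le> U * (\<Sum>n=1..N. a n powr p)"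
    and "\<forall>k. 1 \<le> k \<and> k + 1 \<le> N \<longrightarrow>
           1 / partial_sum l k \<ge> U * (1 / l k - 1 / l (k + 1))"
  shows "lp_op_norm p N (weighted_mean_matrix l) =
    Sup {lp_norm p N (mat_app N (weighted_mean_matrix l) (\<lambda>n. complex_of_real (a n))) |
           a :: nat \<Rightarrow> real.
           lp_norm p N (\<lambda>n. complex_of_real (a n)) = 1 \<and>
           antimono_on {1..N} a \<and> a N \<ge> 0}"
proof -
  obtain a where nn: "\<forall>n\<in>{1..N}. a n \<ge> 0" and unit: "(\<Sum>n=1..N. a n powr p) = 1"
    and max: "\<And>b. \<forall>n\<in>{1..N}. b n \<ge> 0 \<Longrightarrow> (\<Sum>n=1..N. b n powr p) = 1 \<Longrightarrow>
       (\<Sum>n=1..N. \<bar>weighted_mean l b n\<bar> powr p) \<le> (\<Sum>n=1..N. \<bar>weighted_mean l a n\<bar> powr p)"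
    using weighted_mean_maximizer[OF assms(1,2), of l] by blast
  define M where "M = (\<Sum>n=1..N. \<bar>weighted_mean l a n\<bar> powr p)"
  have le: "(\<Sum>n=1..N. \<bar>weighted_mean l b n\<bar> powr p) \<le> M * (\<Sum>n=1..N. \<bar>b n\<bar> powr p)" for b
    unfolding M_def by (rule weighted_mean_bound_of_unit_bound[OF assms(1,3) max])
  have unit': "(\<Sum>n=1..N. \<bar>a n\<bar> powr p) = 1"
    unfolding unit[symmetric] using nn by (intro sum.cong) auto
  \<comment> \<open>Tested on the constant vector 1, whose first mean is 1.\<close>
  have "M > 0"
  proof -
    have "l 1 > 0" using assms(2,3) by auto
    then have "0 < \<bar>weighted_mean l (\<lambda>_. 1) 1\<bar> powr p"
      by (simp add: weighted_mean_def partial_sum_def)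
    also have "\<dots> \<le> (\<Sum>n=1..N. \<bar>weighted_mean l (\<lambda>_. 1) n\<bar> powr p)"
      using assms(2) by (intro member_le_sum) auto
    also note le
    finally show ?thesis using assms(2) by (simp add: zero_less_mult_iff)
  qed
  moreover have "M \<le> U"
  proof -
    have "M = (\<Sum>n=1..N. weighted_mean l a n powr p)"
      unfolding M_def using weighted_mean_nonneg[OF assms(3) nn] by (intro sum.cong) auto
    also have "\<dots> \<le> U * (\<Sum>n=1..N. a n powr p)"
      using assms(5) nn unfolding weighted_mean_def by blast
    finally show ?thesis using unit by simp
  qed
  moreover have "(\<Sum>n=k..N. weighted_mean l a n powr (p - 1) / partial_sum l n) =
      M * a k powr (p - 1) / l k" if "k \<in> {1..N}" for k
    using unit' M_def by (intro weighted_mean_lagrange[OF assms(1,3) nn le _ that]) simp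
  ultimately have anti: "antimono_on {1..N} a"
    by (intro decreasing_of_lagrange[OF assms(1,3) nn _ _ assms(6)])
  let ?A = "\<lambda>b. lp_norm p N (mat_app N (weighted_mean_matrix l) b)"
  let ?a = "\<lambda>n. complex_of_real (a n)"
  have norm_a: "lp_norm p N ?a = 1" using unit' by (simp add: lp_norm_def)
  have Aa: "?A ?a = M powr (1 / p)"
    unfolding lp_norm_def M_def by (simp add: mat_app_of_real)
  have upper: "?A b \<le> ?A ?a" if "lp_norm p N b = 1" for b
  proof -
    have "(\<Sum>n=1..N. cmod (b n) powr p) = ((\<Sum>n=1..N. cmod (b n) powr p) powr (1 / p)) powr p"
      using assms(1) by (simp add: powr_powr sum_nonneg)
    also have "\<dots> = 1" using that by (simp add: lp_norm_def)
    finally have "(\<Sum>n=1..N. \<bar>weighted_mean l (\<lambda>k. cmod (b k)) n\<bar> powr p) \<le> M"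
      using le[of "\<lambda>k. cmod (b k)"] by simp
    moreover have "(\<Sum>n=1..N. cmod (mat_app N (weighted_mean_matrix l) b n) powr p) \<le>
        (\<Sum>n=1..N. \<bar>weighted_mean l (\<lambda>k. cmod (b k)) n\<bar> powr p)"
      using assms(1) cmod_mat_app_le[OF assms(3), of _ b]
      by (intro sum_mono powr_mono2) (auto intro: order_trans[OF _ abs_ge_self])
    ultimately show ?thesis
      unfolding Aa unfolding lp_norm_def using assms(1)
      by (intro powr_mono2) (auto intro: sum_nonneg)
  qed
  \<comment> \<open>Both suprema are maxima attained at \<open>?a\<close>: \<open>upper\<close>
    covers all complex vectors, and \<open>anti\<close> with \<open>nn\<close> places
    \<open>?a\<close> in the smaller set.\<close>
  have "lp_op_norm p N (weighted_mean_matrix l) = ?A ?a"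
    unfolding lp_op_norm_def using norm_a upper by (intro cSup_eq_maximum) auto
  also have "\<dots> = Sup {?A (\<lambda>n. complex_of_real (a n)) | a :: nat \<Rightarrow> real.
      lp_norm p N (\<lambda>n. complex_of_real (a n)) = 1 \<and> antimono_on {1..N} a \<and> a N \<ge> 0}"
    using norm_a upper anti nn assms(2) by (intro cSup_eq_maximum[symmetric]) auto
  finally show ?thesis .
qed

end
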